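(* Let $E$ be a finite-dimensional complex Hilbert space, $e\in E$ a unit vector, $0<\tau<1$, and define $$\Phi(S):=S^{1/2}\bigl(I_E-\tau|e\rangle\langle e|\bigr)S^{1/2},\qquad S\in B(E)_+.$$ For $S\in B(E)_+$ the following are equivalent: (1) $\Phi(S)=S$; (2) $S^{1/2}e=0$; (3) $Se=0$; (4) $\mathrm{ran}(S)\subseteq e^\perp$. In particular, every positive operator supported on $e^\perp$ is a fixed point of $\Phi$. Consequently, for any $T_0\in B(E)_+$, with $T_{n+1}:=\Phi(T_n)$ and $T_\infty:=\lim_nT_n$, the limit $T_\infty$ is a fixed point of $\Phi$, and therefore $T_\infty e=0$ and $\mathrm{ran}(T_\infty)\subseteq e^\perp$.
   Context: For vectors $x,y$, $|x\rangle\langle y|$ denotes the operator $z\mapsto\langle y,z\rangle x$. $B(E)_+$ denotes positive operators; $S^{1/2}$ is the positive square root. The sequence $T_n$ is decreasing in the operator order, so its norm limit exists. *)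

theory Defs
  imports "HOL-Analysis.Analysis"
begin

text \<open>E = complex^'n (finite-dimensional complex Hilbert space), operators = complex^'n^'n.\<close>

definition cinner :: "complex^'n \<Rightarrow> complex^'n \<Rightarrow> complex" where
  "cinner x y = (\<Sum>i\<in>UNIV. cnj (x$i) * y$i)"

definition adjoint_op :: "complex^'n^'n \<Rightarrow> complex^'n^'n" where
  "adjoint_op A = (\<chi> i j. cnj (A$j$i))"

definition positive_op :: "complex^'n^'n \<Rightarrow> bool" where
  "positive_op A \<longleftrightarrow> adjoint_op A = A \<and> (\<forall>x. 0 \<le> Re (cinner x (A *v x)))"

definition sqrt_op :: "complex^'n^'n \<Rightarrow> complex^'n^'n" where
  "sqrt_op S = (THE R. positive_op R \<and> R ** R = S)"

text \<open>ketbra x y is the operator z \<mapsto> cinner y z * x.\<close>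
definition ketbra :: "complex^'n \<Rightarrow> complex^'n \<Rightarrow> complex^'n^'n" where
  "ketbra x y = (\<chi> i j. x$i * cnj (y$j))"

definition Phi :: "real \<Rightarrow> complex^'n \<Rightarrow> complex^'n^'n \<Rightarrow> complex^'n^'n" where
  "Phi \<tau> e S = sqrt_op S ** (mat 1 - \<tau> *\<^sub>R ketbra e e) ** sqrt_op S"

definition orth_compl :: "complex^'n \<Rightarrow> (complex^'n) set" where
  "orth_compl e = {x. cinner e x = 0}"

end

theory Submission
  imports Defs
begin

text \<open>
Writing \<open>R = S\<^sup>1\<^sup>/\<^sup>2\<close>, one has \<open>\<Phi>(S) = S - \<tau> |R e\<rangle>\<langle>R e|\<close>, so \<open>S\<close> is a fixed
point exactly when \<open>R e = 0\<close>; since \<open>\<langle>e, S e\<rangle> = \<parallel>R e\<parallel>\<^sup>2\<close>, this is the same as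
\<open>S e = 0\<close>, which for a self-adjoint \<open>S\<close> says \<open>ran S \<subseteq> e\<^sup>\<bottom>\<close>.
Along the iteration, \<open>T\<^sub>n\<^sub>+\<^sub>1 = T\<^sub>n - \<tau> |u\<^sub>n\<rangle>\<langle>u\<^sub>n|\<close> with
\<open>\<parallel>u\<^sub>n\<parallel>\<^sup>2 = \<langle>e, T\<^sub>n e\<rangle>\<close>. Hence the quadratic forms of the \<open>T\<^sub>n\<close> decrease, and by
polarization \<open>T\<^sub>n\<close> converges entrywise to a positive \<open>T\<^sub>\<infinity>\<close>. The traces telescope,
so \<open>\<tau> \<Sum>\<^sub>n \<langle>e, T\<^sub>n e\<rangle> \<le> tr T\<^sub>0\<close>; thus \<open>\<langle>e, T\<^sub>\<infinity> e\<rangle> = lim \<langle>e, T\<^sub>n e\<rangle> = 0\<close>,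
so \<open>T\<^sub>\<infinity> e = 0\<close> and \<open>T\<^sub>\<infinity>\<close> is a fixed point.
The square root comes from a spectral decomposition, whose eigenvectors are found by
maximizing the quadratic form on the unit sphere.
\<close>

section \<open>The complex inner product\<close>

lemma Re_cinner: "Re (cinner x y) = inner x y"
  by (simp add: cinner_def inner_vec_def inner_complex_def)

lemma cinner_commute: "cinner y x = cnj (cinner x y)"
  by (simp add: cinner_def mult.commute)

lemma cinner_self: "cinner x x = of_real ((norm x)\<^sup>2)"
proof (rule complex_eqI)
  show "Re (cinner x x) = Re (of_real ((norm x)\<^sup>2))"
    by (simp add: Re_cinner power2_norm_eq_inner)
  show "Im (cinner x x) = Im (of_real ((norm x)\<^sup>2))"
    by (simp add: cinner_def)
qed

lemma cinner_self_eq_0_iff: "cinner x x = 0 \<longleftrightarrow> x = 0"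
  by (simp add: cinner_self)

lemma cinner_zero_left [simp]: "cinner 0 x = 0"
  and cinner_zero_right [simp]: "cinner x 0 = 0"
  by (simp_all add: cinner_def)

lemma cinner_diff_left: "cinner (x - y) z = cinner x z - cinner y z"
  and cinner_diff_right: "cinner x (y - z) = cinner x y - cinner x z"
  by (simp_all add: cinner_def left_diff_distrib right_diff_distrib sum_subtractf)

lemma cinner_scaleR_left: "cinner (r *\<^sub>R x) y = of_real r * cinner x y"
  by (simp add: cinner_def sum_distrib_left scaleR_conv_of_real[where 'a=complex] mult_ac)

lemma cinner_scale_left: "cinner (c *s x) y = cnj c * cinner x y"
  and cinner_scale_right: "cinner x (c *s y) = c * cinner x y"
  by (simp_all add: cinner_def sum_distrib_left mult_ac)

lemma cinner_eq_Complex: "cinner x y = Complex (inner x y) (inner (\<i> *s x) y)"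
  by (simp add: complex_eq_iff Re_cinner[symmetric] cinner_scale_left)

lemma cinner_axis_matrix_axis: "cinner (axis i 1) (A *v axis j 1) = A $ i $ j"
  by (simp add: cinner_def axis_def matrix_vector_mult_def if_distrib if_distribR cong: if_cong)

lemma cmod_cinner_unit_le:
  assumes "norm e = 1"
  shows "(cmod (cinner e y))\<^sup>2 \<le> (norm y)\<^sup>2"
proof -
  define a where "a = cinner e y"
  have ee: "cinner e e = 1"
    using assms by (simp add: cinner_self)
  have "cinner (y - a *s e) (y - a *s e) = cinner y y - a * cnj a"
    by (simp add: cinner_diff_left cinner_diff_right cinner_scale_left cinner_scale_right ee
        cinner_commute[of y e] a_def[symmetric] algebra_simps)
  then have "of_real ((norm (y - a *s e))\<^sup>2) = (of_real ((norm y)\<^sup>2 - (cmod a)\<^sup>2) :: complex)"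
    by (simp only: cinner_self complex_norm_square of_real_diff)
  then have "(norm (y - a *s e))\<^sup>2 = (norm y)\<^sup>2 - (cmod a)\<^sup>2"
    by (simp only: of_real_eq_iff)
  then show ?thesis
    unfolding a_def[symmetric] by (metis diff_ge_0_iff_ge zero_le_power2)
qed

section \<open>Matrices acting on \<open>complex^'n\<close>\<close>

lemma matrix_vector_mult_scaleR: "(A::complex^'n^'m) *v (r *\<^sub>R x) = r *\<^sub>R (A *v x)"
  and scaleR_matrix_vector_mult: "(r *\<^sub>R (A::complex^'n^'m)) *v x = r *\<^sub>R (A *v x)"
  and matrix_vector_mult_scale: "(A::complex^'n^'m) *v (c *s x) = c *s (A *v x)"
  by (simp_all add: matrix_vector_mult_def vec_eq_iff sum_distrib_left
      scaleR_conv_of_real[where 'a=complex] mult_ac)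

lemma sum_matrix_vector_mult: "finite I \<Longrightarrow> sum f I *v (x::complex^'n) = (\<Sum>i\<in>I. f i *v x)"
  by (induction I rule: finite_induct) (simp_all add: matrix_vector_mult_add_rdistrib)

lemma sum_matrix_mult: "finite I \<Longrightarrow> sum f I ** (B::complex^'n^'n) = (\<Sum>i\<in>I. f i ** B)"
  by (induction I rule: finite_induct)
    (simp_all add: matrix_matrix_mult_def vec_eq_iff distrib_right sum.distrib)

lemma matrix_mult_sum: "finite I \<Longrightarrow> (B::complex^'n^'n) ** sum f I = (\<Sum>i\<in>I. B ** f i)"
  by (induction I rule: finite_induct) (simp_all add: matrix_add_ldistrib)

lemma ketbra_apply: "ketbra x y *v z = cinner y z *s x"
  by (simp add: ketbra_def cinner_def matrix_vector_mult_def vec_eq_iff sum_distrib_left mult_ac)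

lemma ketbra_zero_left [simp]: "ketbra 0 y = 0"
  by (simp add: ketbra_def vec_eq_iff)

lemma ketbra_mult_ketbra: "ketbra a b ** ketbra c d = ketbra (cinner b c *s a) d"
  by (simp add: ketbra_def matrix_matrix_mult_def cinner_def vec_eq_iff sum_distrib_left
      sum_distrib_right mult_ac)

lemma inner_ketbra_self: "inner x (ketbra u u *v x) = (cmod (cinner u x))\<^sup>2"
proof -
  have "inner x (ketbra u u *v x) = Re (cinner u x * cnj (cinner u x))"
    by (simp add: ketbra_apply Re_cinner[symmetric] cinner_scale_right cinner_commute[of x u])
  also have "\<dots> = (cmod (cinner u x))\<^sup>2"
    by (simp add: complex_norm_square[symmetric])
  finally show ?thesis .
qed

lemma ketbra_self_eq_0_iff: "ketbra u u = 0 \<longleftrightarrow> u = 0"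
proof
  assume "ketbra u u = 0"
  then have "cinner u u *s u = 0"
    by (metis ketbra_apply matrix_vector_mult_0)
  then have "cinner u u * cinner u u = 0"
    by (metis cinner_scale_right cinner_zero_right)
  then show "u = 0"
    by (simp add: cinner_self_eq_0_iff)
qed simp

lemma adjoint_op_cinner: "cinner x (A *v y) = cinner (adjoint_op A *v x) y"
  unfolding cinner_def adjoint_op_def matrix_vector_mult_def
  by (simp add: sum_distrib_left sum_distrib_right mult_ac) (rule sum.swap)

lemma adjoint_op_diff: "adjoint_op (A - B) = adjoint_op A - adjoint_op B"
  and adjoint_op_uminus: "adjoint_op (- A) = - adjoint_op A"
  and adjoint_op_scaleR: "adjoint_op (r *\<^sub>R A) = r *\<^sub>R adjoint_op A"
  and adjoint_op_ketbra: "adjoint_op (ketbra x y) = ketbra y x"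
  by (simp_all add: adjoint_op_def ketbra_def vec_eq_iff scaleR_conv_of_real[where 'a=complex]
      mult.commute)

lemma adjoint_op_sum: "adjoint_op (sum f I) = (\<Sum>i\<in>I. adjoint_op (f i))"
  by (simp add: adjoint_op_def vec_eq_iff)

lemma adjoint_op_matrix_mult: "adjoint_op (A ** B) = adjoint_op B ** adjoint_op A"
  by (simp add: adjoint_op_def matrix_matrix_mult_def vec_eq_iff mult.commute)

lemma tendsto_matrix_vector_mult:
  "(f \<longlongrightarrow> (L::complex^'n^'m)) F \<Longrightarrow> ((\<lambda>n. f n *v x) \<longlongrightarrow> L *v x) F"
  unfolding matrix_vector_mult_def
  by (intro vec_tendstoI) (simp add: tendsto_sum tendsto_mult_right tendsto_vec_nth)

lemma tendsto_adjoint_op: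
  "(f \<longlongrightarrow> (L::complex^'n^'n)) F \<Longrightarrow> ((\<lambda>n. adjoint_op (f n)) \<longlongrightarrow> adjoint_op L) F"
  unfolding adjoint_op_def by (intro vec_tendstoI) (simp add: tendsto_cnj tendsto_vec_nth)

lemma Re_trace_ketbra_self: "Re (trace (ketbra u u)) = (norm u)\<^sup>2"
  by (simp add: trace_def ketbra_def power2_norm_eq_inner inner_vec_def inner_complex_def)

lemma Re_trace_diff_scaleR: "Re (trace (A - r *\<^sub>R B)) = Re (trace A) - r * Re (trace B)"
  by (simp add: trace_def sum_subtractf sum_distrib_left)

section \<open>Hermitian and positive matrices\<close>

lemma hermitian_cinner_commute:
  "adjoint_op A = A \<Longrightarrow> cinner x (A *v y) = cinner (A *v x) y"
  by (metis adjoint_op_cinner)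

lemma hermitian_inner_commute:
  "adjoint_op A = A \<Longrightarrow> inner x (A *v y) = inner (A *v x) y"
  by (metis Re_cinner adjoint_op_cinner)

lemma hermitian_quadratic_form_expand:
  assumes "adjoint_op A = A"
  shows "inner (x + t *\<^sub>R y) (A *v (x + t *\<^sub>R y))
           = inner x (A *v x) + 2 * t * inner y (A *v x) + t\<^sup>2 * inner y (A *v y)"
  using hermitian_inner_commute[OF assms, of x y]
  by (simp add: matrix_vector_mult_scaleR power2_eq_square inner_commute algebra_simps)

lemma hermitian_polarization:
  assumes "adjoint_op A = A"
  shows "inner x (A *v y) = (inner (x + y) (A *v (x + y)) - inner (x - y) (A *v (x - y))) / 4"
  using hermitian_inner_commute[OF assms, of x y]
  by (simp add: inner_commute algebra_simps)

lemma hermitian_eq_0: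
  assumes h: "adjoint_op A = A" and q: "\<And>x. inner x (A *v x) = 0"
  shows "A = 0"
proof -
  have "inner (A *v y) (A *v y) = 0" for y
    using hermitian_polarization[OF h, of "A *v y" y] by (simp add: q)
  then show ?thesis
    by (simp add: matrix_eq)
qed

lemma hermitian_square_quadratic_form:
  "adjoint_op R = R \<Longrightarrow> inner x ((R ** R) *v x) = (norm (R *v x))\<^sup>2"
  by (simp add: matrix_vector_mul_assoc[symmetric] hermitian_inner_commute power2_norm_eq_inner)

lemma positive_op_iff: "positive_op S \<longleftrightarrow> adjoint_op S = S \<and> (\<forall>x. 0 \<le> inner x (S *v x))"
  by (simp add: positive_op_def Re_cinner)

lemma quadratic_nonneg_imp_linear_coeff_0:
  fixes a b :: real
  assumes "\<And>t. 0 \<le> 2 * t * a + t\<^sup>2 * b"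
  shows "a = 0"
proof (rule ccontr)
  assume a: "a \<noteq> 0"
  define c where "c = \<bar>b\<bar> + 1"
  define t where "t = - a / c"
  have c: "c > 0" "b < c" by (auto simp: c_def)
  have "c\<^sup>2 * (2 * t * a + t\<^sup>2 * b) = a\<^sup>2 * (b - 2 * c)"
    using c by (simp add: t_def field_simps power2_eq_square)
  moreover have "a\<^sup>2 * (b - 2 * c) < 0"
    using a c by (intro mult_pos_neg) auto
  moreover have "0 \<le> c\<^sup>2 * (2 * t * a + t\<^sup>2 * b)"
    using assms by simp
  ultimately show False by simp
qed

text \<open>Perturb \<open>v\<close> along \<open>R v\<close>: the linear coefficient of the quadratic form is \<open>2 \<parallel>R v\<parallel>\<^sup>2\<close>.\<close>
lemma positive_op_apply_eq_0:
  assumes p: "positive_op R" and z: "inner v (R *v v) = 0"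
  shows "R *v v = 0"
proof -
  have h: "adjoint_op R = R" using p by (simp add: positive_op_iff)
  have "0 \<le> 2 * t * inner (R *v v) (R *v v) + t\<^sup>2 * inner (R *v v) (R *v (R *v v))" for t
  proof -
    have "0 \<le> inner (v + t *\<^sub>R (R *v v)) (R *v (v + t *\<^sub>R (R *v v)))"
      using p by (simp add: positive_op_iff)
    then show ?thesis
      using z by (simp add: hermitian_quadratic_form_expand[OF h] inner_commute)
  qed
  then have "inner (R *v v) (R *v v) = 0"
    by (rule quadratic_nonneg_imp_linear_coeff_0)
  then show ?thesis by simp
qed

section \<open>Spectral decomposition\<close>

lemma quadratic_form_max_on_sphere:
  fixes S :: "complex^'n^'n"
  obtains v where "norm v = 1" "\<And>y. inner y (S *v y) \<le> inner v (S *v v) * (norm y)\<^sup>2"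
proof -
  have "continuous_on (sphere 0 1) (\<lambda>y::complex^'n. inner y (S *v y))"
    by (intro continuous_intros linear_continuous_on matrix_vector_mul_bounded_linear)
  moreover have "sphere (0::complex^'n) 1 \<noteq> {}"
    by simp
  ultimately obtain v where v: "v \<in> sphere 0 1"
    and max: "\<And>y. y \<in> sphere 0 1 \<Longrightarrow> inner y (S *v y) \<le> inner v (S *v v)"
    using continuous_attains_sup[OF compact_sphere] by blast
  have "inner y (S *v y) \<le> inner v (S *v v) * (norm y)\<^sup>2" for y
  proof (cases "y = 0")
    case False
    define u where "u = (1 / norm y) *\<^sub>R y"
    have "y = norm y *\<^sub>R u" using False by (simp add: u_def)
    then have "inner y (S *v y) = (norm y)\<^sup>2 * inner u (S *v u)"
      by (metis matrix_vector_mult_scaleR inner_scaleR_left inner_scaleR_right mult.assoc power2_eq_square)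
    also have "\<dots> \<le> (norm y)\<^sup>2 * inner v (S *v v)"
      using False by (intro mult_left_mono max) (auto simp: u_def)
    finally show ?thesis by (simp add: mult.commute)
  qed simp
  with v that show ?thesis by simp
qed

text \<open>Rayleigh: if \<open>v\<close> maximizes the quadratic form on the unit sphere, then
  \<open>w = S v - M v\<close> satisfies \<open>q(v + t w) \<le> M \<parallel>v + t w\<parallel>\<^sup>2\<close> for all real \<open>t\<close>, whose linear
  coefficient is \<open>-\<parallel>w\<parallel>\<^sup>2\<close>.\<close>
lemma hermitian_maximizer_eigenvector:
  fixes S :: "complex^'n^'n"
  assumes h: "adjoint_op S = S" and v: "norm v = 1"
    and max: "\<And>y. inner y (S *v y) \<le> inner v (S *v v) * (norm y)\<^sup>2"
  shows "S *v v = inner v (S *v v) *\<^sub>R v"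
proof -
  define M where "M = inner v (S *v v)"
  define w where "w = S *v v - M *\<^sub>R v"
  have vv: "inner v v = 1"
    using v by (simp add: power2_norm_eq_inner[symmetric])
  have ww: "inner w w = inner w (S *v v) - M * inner v w"
    using inner_diff_right[of w "S *v v" "M *\<^sub>R v"] by (simp add: w_def[symmetric] inner_commute)
  have "0 \<le> 2 * t * (- inner w w) + t\<^sup>2 * (M * inner w w - inner w (S *v w))" for t
  proof -
    have norm: "(norm (v + t *\<^sub>R w))\<^sup>2 = 1 + 2 * t * inner v w + t\<^sup>2 * inner w w"
      unfolding power2_norm_eq_inner using vv
      by (simp add: power2_eq_square inner_commute algebra_simps)
    show ?thesis
      using max[of "v + t *\<^sub>R w"]
      unfolding hermitian_quadratic_form_expand[OF h] norm M_def[symmetric] ww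
      by (simp add: algebra_simps)
  qed
  then have "- inner w w = 0"
    by (rule quadratic_nonneg_imp_linear_coeff_0)
  then show ?thesis
    by (simp add: w_def M_def)
qed

lemma hermitian_eigenvector_pos:
  fixes S :: "complex^'n^'n"
  assumes h: "adjoint_op S = S" and x: "inner x (S *v x) > 0"
  obtains v \<mu> where "norm v = 1" "\<mu> > 0" "S *v v = \<mu> *\<^sub>R v"
proof -
  obtain v where v: "norm v = 1" and max: "\<And>y. inner y (S *v y) \<le> inner v (S *v v) * (norm y)\<^sup>2"
    using quadratic_form_max_on_sphere by blast
  have "0 < inner v (S *v v) * (norm x)\<^sup>2"
    using x max[of x] by linarith
  then have "inner v (S *v v) > 0"
    by (simp add: zero_less_mult_iff)
  from that[OF v this hermitian_maximizer_eigenvector[OF h v max]] show ?thesis .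
qed

lemma hermitian_eigenvector:
  fixes S :: "complex^'n^'n"
  assumes h: "adjoint_op S = S" and nz: "S \<noteq> 0"
  obtains v \<mu> where "norm v = 1" "\<mu> \<noteq> 0" "S *v v = \<mu> *\<^sub>R v"
proof -
  obtain x where x: "inner x (S *v x) \<noteq> 0"
    using hermitian_eq_0[OF h] nz by blast
  show ?thesis
  proof (cases "inner x (S *v x) > 0")
    case True
    then obtain v \<mu> where v: "norm v = 1" and "\<mu> > 0" and Sv: "S *v v = \<mu> *\<^sub>R v"
      by (rule hermitian_eigenvector_pos[OF h])
    then have "\<mu> \<noteq> 0" by simp
    from v this Sv show ?thesis by (rule that)
  next
    case False
    have neg: "(- S) *v y = - (S *v y)" for y
      by (simp add: matrix_vector_mult_def vec_eq_iff sum_negf)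
    have "adjoint_op (- S) = - S" "inner x ((- S) *v x) > 0"
      using h False x by (simp_all add: adjoint_op_uminus neg)
    then obtain v \<mu> where "norm v = 1" "\<mu> > 0" "(- S) *v v = \<mu> *\<^sub>R v"
      by (rule hermitian_eigenvector_pos)
    then show ?thesis
      using that[of v "- \<mu>"] by (simp add: neg minus_equation_iff[of "S *v v"])
  qed
qed

lemma hermitian_eigenvector_orthogonal_kernel:
  assumes h: "adjoint_op S = S" and v: "S *v v = \<mu> *\<^sub>R v" and \<mu>: "\<mu> \<noteq> 0"
    and x: "S *v x = 0"
  shows "cinner v x = 0"
proof -
  have "of_real \<mu> * cinner v x = cinner v (S *v x)"
    by (simp add: hermitian_cinner_commute[OF h] v cinner_scaleR_left)
  then show ?thesis using x \<mu> by simp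
qed

definition spectral_decomp :: "complex^'n^'n \<Rightarrow> nat \<Rightarrow> (nat \<Rightarrow> complex^'n) \<Rightarrow> (nat \<Rightarrow> real) \<Rightarrow> bool"
  where "spectral_decomp S m v \<mu> \<longleftrightarrow>
    (\<forall>i<m. \<forall>j<m. cinner (v i) (v j) = (if i = j then 1 else 0)) \<and> (\<forall>i<m. \<mu> i \<noteq> 0) \<and>
    S = (\<Sum>i<m. \<mu> i *\<^sub>R ketbra (v i) (v i))"

lemma spectral_decomp_eigenvector:
  assumes d: "spectral_decomp S m v \<mu>" and j: "j < m"
  shows "S *v v j = \<mu> j *\<^sub>R v j"
proof -
  have "S *v v j = (\<Sum>i<m. \<mu> i *\<^sub>R (cinner (v i) (v j) *s v i))"
    using d by (simp add: spectral_decomp_def sum_matrix_vector_mult scaleR_matrix_vector_mult ketbra_apply)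
  also have "\<dots> = (\<Sum>i<m. if i = j then \<mu> j *\<^sub>R v j else 0)"
    using d j by (intro sum.cong) (auto simp: spectral_decomp_def)
  finally show ?thesis using j by simp
qed

lemma spectral_decomp_extend:
  assumes d: "spectral_decomp S m w \<nu>" and vv: "cinner v v = 1" and \<mu>: "\<mu> \<noteq> 0"
    and orth: "\<And>j. j < m \<Longrightarrow> cinner v (w j) = 0"
  shows "spectral_decomp (S + \<mu> *\<^sub>R ketbra v v) (Suc m) (w(m := v)) (\<nu>(m := \<mu>))"
  unfolding spectral_decomp_def
proof (intro conjI allI impI)
  fix i j assume ij: "i < Suc m" "j < Suc m"
  have "cinner (w i) v = 0" if "i < m"
    using orth[OF that] cinner_commute[of "w i" v] by simp
  with d vv orth ij show "cinner ((w(m := v)) i) ((w(m := v)) j) = (if i = j then 1 else 0)"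
    by (cases "i = m"; cases "j = m") (auto simp: spectral_decomp_def)
next
  fix i assume "i < Suc m"
  then show "(\<nu>(m := \<mu>)) i \<noteq> 0"
    using d \<mu> by (auto simp: spectral_decomp_def)
next
  show "S + \<mu> *\<^sub>R ketbra v v = (\<Sum>i<Suc m. (\<nu>(m := \<mu>)) i *\<^sub>R ketbra ((w(m := v)) i) ((w(m := v)) i))"
    using d by (simp add: spectral_decomp_def)
qed

lemma hermitian_deflation_enlarges_kernel:
  fixes S :: "complex^'n^'n"
  assumes h: "adjoint_op S = S" and Sv: "S *v v = \<mu> *\<^sub>R v" and \<mu>: "\<mu> \<noteq> 0"
    and vv: "cinner v v = 1"
  shows "dim {x. S *v x = 0} < dim {x. (S - \<mu> *\<^sub>R ketbra v v) *v x = 0}"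
proof -
  have kernel: "subspace {x. A *v x = 0}" for A :: "complex^'n^'n"
    by (simp add: subspace_def matrix_vector_right_distrib matrix_vector_mult_scaleR)
  have apply_deflation: "(S - \<mu> *\<^sub>R ketbra v v) *v x = S *v x - \<mu> *\<^sub>R (cinner v x *s v)" for x
    by (simp add: matrix_vector_mult_diff_rdistrib scaleR_matrix_vector_mult ketbra_apply)
  have "{x. S *v x = 0} \<subseteq> {x. (S - \<mu> *\<^sub>R ketbra v v) *v x = 0}"
    using hermitian_eigenvector_orthogonal_kernel[OF h Sv \<mu>] by (auto simp: apply_deflation)
  moreover have "v \<in> {x. (S - \<mu> *\<^sub>R ketbra v v) *v x = 0}"
    by (simp add: apply_deflation Sv vv)
  moreover have "v \<notin> {x. S *v x = 0}"
  proof -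
    have "v \<noteq> 0"
      using vv by auto
    then show ?thesis
      using Sv \<mu> by simp
  qed
  ultimately show ?thesis
    by (intro dim_psubset) (auto simp: span_eq_iff[THEN iffD2, OF kernel])
qed

text \<open>Induction on the codimension of the kernel, splitting off one eigenvector at a time.\<close>
lemma hermitian_spectral_decomp:
  fixes S :: "complex^'n^'n"
  assumes "adjoint_op S = S"
  obtains m v \<mu> where "spectral_decomp S m v \<mu>"
  using assms
proof (induction "DIM(complex^'n) - dim {x. S *v x = 0}" arbitrary: S thesis rule: less_induct)
  case less
  show ?case
  proof (cases "S = 0")
    case True
    then show ?thesis
      using less.prems(1)[of 0 "\<lambda>_. 0" "\<lambda>_. 0"] by (simp add: spectral_decomp_def)
  next
    case False
    have h: "adjoint_op S = S" by (rule less.prems(2))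
    obtain v \<mu> where v: "norm v = 1" and \<mu>: "\<mu> \<noteq> 0" and Sv: "S *v v = \<mu> *\<^sub>R v"
      using hermitian_eigenvector[OF h False] by blast
    have vv: "cinner v v = 1" using v by (simp add: cinner_self)
    define S' where "S' = S - \<mu> *\<^sub>R ketbra v v"
    have h': "adjoint_op S' = S'"
      using h by (simp add: S'_def adjoint_op_diff adjoint_op_scaleR adjoint_op_ketbra)
    have S'v: "S' *v v = 0"
      by (simp add: S'_def matrix_vector_mult_diff_rdistrib scaleR_matrix_vector_mult ketbra_apply vv Sv)
    have "dim {x. S *v x = 0} < dim {x. S' *v x = 0}"
      unfolding S'_def using h Sv \<mu> vv by (rule hermitian_deflation_enlarges_kernel)
    moreover have "dim {x. S' *v x = 0} \<le> DIM(complex^'n)"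
      by (rule dim_subset_UNIV)
    ultimately have less': "DIM(complex^'n) - dim {x. S' *v x = 0} < DIM(complex^'n) - dim {x. S *v x = 0}"
      by linarith
    obtain m w \<nu> where d: "spectral_decomp S' m w \<nu>"
      using less.hyps[OF less' _ h'] by blast
    have "cinner v (w j) = 0" if "j < m" for j
      using hermitian_eigenvector_orthogonal_kernel[OF h' spectral_decomp_eigenvector[OF d that] _ S'v]
        d that cinner_commute[of v "w j"] by (simp add: spectral_decomp_def)
    from spectral_decomp_extend[OF d vv \<mu> this] show ?thesis
      by (intro less.prems(1)) (simp add: S'_def)
  qed
qed

section \<open>The positive square root\<close>

lemma positive_sqrt_exists:
  fixes S :: "complex^'n^'n"
  assumes p: "positive_op S"
  shows "\<exists>R. positive_op R \<and> R ** R = S"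
proof -
  have "adjoint_op S = S"
    using p by (simp add: positive_op_iff)
  then obtain m v \<mu> where d: "spectral_decomp S m v \<mu>"
    by (rule hermitian_spectral_decomp)
  have \<mu>: "0 \<le> \<mu> i" if i: "i < m" for i
  proof -
    have "inner (v i) (v i) = 1"
      using d i by (simp add: spectral_decomp_def Re_cinner[symmetric])
    then have "inner (v i) (S *v v i) = \<mu> i"
      by (simp add: spectral_decomp_eigenvector[OF d i])
    then show ?thesis using p by (metis positive_op_iff)
  qed
  define R where "R = (\<Sum>i<m. sqrt (\<mu> i) *\<^sub>R ketbra (v i) (v i))"
  have "adjoint_op R = R"
    by (simp add: R_def adjoint_op_sum adjoint_op_scaleR adjoint_op_ketbra)
  moreover have "0 \<le> inner x (R *v x)" for x
    using \<mu> by (auto simp: R_def sum_matrix_vector_mult scaleR_matrix_vector_mult inner_sum_right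
        inner_ketbra_self intro!: sum_nonneg)
  moreover have "R ** R = S"
  proof -
    have KK: "ketbra (v i) (v i) ** ketbra (v j) (v j) = (if i = j then ketbra (v i) (v i) else 0)"
      if "i < m" "j < m" for i j
      using d that by (simp add: ketbra_mult_ketbra spectral_decomp_def)
    have "R ** R = (\<Sum>j<m. \<Sum>i<m.
        (sqrt (\<mu> i) * sqrt (\<mu> j)) *\<^sub>R (ketbra (v i) (v i) ** ketbra (v j) (v j)))"
      by (simp add: R_def sum_matrix_mult matrix_mult_sum scalar_matrix_assoc[symmetric] matrix_scalar_ac
          scaleR_sum_right mult.commute)
    also have "\<dots> = (\<Sum>j<m. \<Sum>i<m. if i = j then \<mu> i *\<^sub>R ketbra (v i) (v i) else 0)"
      using \<mu> KK by (intro sum.cong refl) (auto simp: real_sqrt_mult[symmetric])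
    also have "\<dots> = S"
      using d by (simp add: spectral_decomp_def)
    finally show ?thesis .
  qed
  ultimately show ?thesis by (auto simp: positive_op_iff)
qed

text \<open>If \<open>(R\<^sub>1 - R\<^sub>2) v = \<mu> v\<close> with \<open>\<mu> \<noteq> 0\<close>, comparing \<open>\<langle>v, R\<^sub>1\<^sup>2 v\<rangle>\<close> with \<open>\<langle>v, R\<^sub>2\<^sup>2 v\<rangle>\<close> gives
  \<open>\<mu> (\<langle>v, R\<^sub>1 v\<rangle> + \<langle>v, R\<^sub>2 v\<rangle>) = 0\<close>, so both quadratic forms vanish at \<open>v\<close>.\<close>
lemma positive_sqrt_unique:
  fixes R1 R2 :: "complex^'n^'n"
  assumes p1: "positive_op R1" and p2: "positive_op R2" and eq: "R1 ** R1 = R2 ** R2"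
  shows "R1 = R2"
proof (rule ccontr)
  assume "R1 \<noteq> R2"
  have h1: "adjoint_op R1 = R1" and h2: "adjoint_op R2 = R2"
    using p1 p2 by (simp_all add: positive_op_iff)
  then have "adjoint_op (R1 - R2) = R1 - R2" by (simp add: adjoint_op_diff)
  then obtain v \<mu> where v: "norm v = 1" and \<mu>: "\<mu> \<noteq> 0" and Dv: "(R1 - R2) *v v = \<mu> *\<^sub>R v"
    using hermitian_eigenvector \<open>R1 \<noteq> R2\<close> by (metis eq_iff_diff_eq_0)
  have R1v: "R1 *v v = R2 *v v + \<mu> *\<^sub>R v"
    using Dv by (simp add: algebra_simps)
  have "inner v (R1 *v (R1 *v v)) = inner v (R2 *v (R2 *v v))"
    using eq by (simp add: matrix_vector_mul_assoc)
  moreover have "inner v (R1 *v (R1 *v v)) = inner v (R1 *v (R2 *v v)) + \<mu> * inner v (R1 *v v)"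
    by (simp add: R1v matrix_vector_right_distrib matrix_vector_mult_scaleR inner_add_right)
  moreover have "inner v (R1 *v (R2 *v v)) = inner v (R2 *v (R2 *v v)) + \<mu> * inner v (R2 *v v)"
    by (simp add: hermitian_inner_commute[OF h1] hermitian_inner_commute[OF h2, of v "R2 *v v"]
        R1v inner_add_left)
  ultimately have "\<mu> * (inner v (R1 *v v) + inner v (R2 *v v)) = 0"
    by (simp add: algebra_simps)
  moreover have "0 \<le> inner v (R1 *v v)" "0 \<le> inner v (R2 *v v)"
    using p1 p2 by (simp_all add: positive_op_iff)
  ultimately have "inner v (R1 *v v) = 0" "inner v (R2 *v v) = 0"
    using \<mu> by simp_all
  then have "(R1 - R2) *v v = 0"
    using p1 p2 by (simp add: matrix_vector_mult_diff_rdistrib positive_op_apply_eq_0)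
  with Dv \<mu> v show False by simp
qed

lemma positive_sqrt_op:
  fixes S :: "complex^'n^'n"
  assumes "positive_op S"
  shows positive_op_sqrt_op: "positive_op (sqrt_op S)"
    and sqrt_op_mult_self: "sqrt_op S ** sqrt_op S = S"
proof -
  have "\<exists>!R. positive_op R \<and> R ** R = S"
    using positive_sqrt_exists[OF assms] positive_sqrt_unique by blast
  then have "positive_op (sqrt_op S) \<and> sqrt_op S ** sqrt_op S = S"
    unfolding sqrt_op_def by (rule theI')
  then show "positive_op (sqrt_op S)" "sqrt_op S ** sqrt_op S = S" by simp_all
qed

lemma sqrt_op_quadratic_form:
  "positive_op S \<Longrightarrow> inner x (S *v x) = (norm (sqrt_op S *v x))\<^sup>2"
  by (metis hermitian_square_quadratic_form positive_op_iff positive_op_sqrt_op sqrt_op_mult_self)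

section \<open>The map \<open>\<Phi>\<close>\<close>

lemma Phi_eq:
  assumes p: "positive_op S"
  shows "Phi \<tau> e S = S - \<tau> *\<^sub>R ketbra (sqrt_op S *v e) (sqrt_op S *v e)"
proof -
  let ?R = "sqrt_op S"
  have h: "adjoint_op ?R = ?R"
    using positive_op_sqrt_op[OF p] by (simp add: positive_op_iff)
  have "Phi \<tau> e S *v x = (S - \<tau> *\<^sub>R ketbra (?R *v e) (?R *v e)) *v x" for x
  proof -
    have "Phi \<tau> e S *v x = ?R *v ((mat 1 - \<tau> *\<^sub>R ketbra e e) *v (?R *v x))"
      by (simp only: Phi_def matrix_vector_mul_assoc matrix_mul_assoc)
    also have "\<dots> = ?R *v (?R *v x) - \<tau> *\<^sub>R (cinner e (?R *v x) *s (?R *v e))"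
      by (simp add: matrix_vector_mult_diff_rdistrib matrix_vector_mult_diff_distrib
          scaleR_matrix_vector_mult matrix_vector_mult_scaleR matrix_vector_mult_scale ketbra_apply)
    also have "\<dots> = (S - \<tau> *\<^sub>R ketbra (?R *v e) (?R *v e)) *v x"
      by (simp add: matrix_vector_mul_assoc sqrt_op_mult_self[OF p] matrix_vector_mult_diff_rdistrib
          scaleR_matrix_vector_mult ketbra_apply hermitian_cinner_commute[OF h])
    finally show ?thesis .
  qed
  then show ?thesis
    by (simp add: matrix_eq)
qed

lemma Phi_fixed_iff:
  assumes "positive_op S" and "\<tau> \<noteq> 0"
  shows "Phi \<tau> e S = S \<longleftrightarrow> sqrt_op S *v e = 0"
  using assms by (simp add: Phi_eq ketbra_self_eq_0_iff)

lemma sqrt_op_apply_eq_0_iff: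
  assumes p: "positive_op S"
  shows "sqrt_op S *v e = 0 \<longleftrightarrow> S *v e = 0"
proof
  assume "sqrt_op S *v e = 0"
  then show "S *v e = 0"
    by (metis matrix_vector_mul_assoc matrix_vector_mult_0_right sqrt_op_mult_self[OF p])
next
  assume "S *v e = 0"
  then show "sqrt_op S *v e = 0"
    using sqrt_op_quadratic_form[OF p, of e] by simp
qed

lemma hermitian_apply_eq_0_iff_range_orth:
  assumes h: "adjoint_op S = S"
  shows "S *v e = 0 \<longleftrightarrow> range ((*v) S) \<subseteq> orth_compl e"
proof
  assume "S *v e = 0"
  then show "range ((*v) S) \<subseteq> orth_compl e"
    by (auto simp: orth_compl_def hermitian_cinner_commute[OF h])
next
  assume "range ((*v) S) \<subseteq> orth_compl e"
  then have "cinner (S *v e) (S *v e) = 0"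
    by (auto simp: orth_compl_def hermitian_cinner_commute[OF h, symmetric])
  then show "S *v e = 0"
    by (simp add: cinner_self_eq_0_iff)
qed

lemma positive_op_congruence:
  assumes p: "positive_op P" and h: "adjoint_op R = R"
  shows "positive_op (R ** P ** R)"
  unfolding positive_op_iff
proof
  show "adjoint_op (R ** P ** R) = R ** P ** R"
    using p h by (simp add: adjoint_op_matrix_mult positive_op_iff matrix_mul_assoc)
  show "\<forall>x. 0 \<le> inner x ((R ** P ** R) *v x)"
    using p by (simp add: matrix_vector_mul_assoc[symmetric] hermitian_inner_commute[OF h] positive_op_iff)
qed

lemma positive_op_id_minus_ketbra:
  assumes e: "norm e = 1" and \<tau>: "\<tau> \<le> 1"
  shows "positive_op (mat 1 - \<tau> *\<^sub>R ketbra e e)"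
  unfolding positive_op_iff
proof
  have "adjoint_op (mat 1 :: complex^'n^'n) = mat 1"
    by (simp add: adjoint_op_def mat_def vec_eq_iff)
  then show "adjoint_op (mat 1 - \<tau> *\<^sub>R ketbra e e) = mat 1 - \<tau> *\<^sub>R ketbra e e"
    by (simp add: adjoint_op_diff adjoint_op_scaleR adjoint_op_ketbra)
  show "\<forall>x. 0 \<le> inner x ((mat 1 - \<tau> *\<^sub>R ketbra e e) *v x)"
  proof
    fix x
    have "\<tau> * (cmod (cinner e x))\<^sup>2 \<le> 1 * (cmod (cinner e x))\<^sup>2"
      using \<tau> by (intro mult_right_mono) simp_all
    also have "\<dots> \<le> (norm x)\<^sup>2"
      using cmod_cinner_unit_le[OF e, of x] by simp
    finally have "\<tau> * (cmod (cinner e x))\<^sup>2 \<le> (norm x)\<^sup>2" .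
    then show "0 \<le> inner x ((mat 1 - \<tau> *\<^sub>R ketbra e e) *v x)"
      by (simp add: matrix_vector_mult_diff_rdistrib scaleR_matrix_vector_mult inner_diff_right
          inner_ketbra_self power2_norm_eq_inner)
  qed
qed

lemma positive_op_Phi:
  assumes "positive_op S" and "norm e = 1" and "\<tau> \<le> 1"
  shows "positive_op (Phi \<tau> e S)"
  unfolding Phi_def using assms positive_op_sqrt_op
  by (intro positive_op_congruence positive_op_id_minus_ketbra) (auto simp: positive_op_iff)

lemma Phi_quadratic_form_le:
  assumes "positive_op S" and "0 \<le> \<tau>"
  shows "inner x (Phi \<tau> e S *v x) \<le> inner x (S *v x)"
  using assms by (simp add: Phi_eq matrix_vector_mult_diff_rdistrib scaleR_matrix_vector_mult
      inner_diff_right inner_ketbra_self)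

lemma Re_trace_Phi:
  assumes "positive_op S"
  shows "Re (trace (Phi \<tau> e S)) = Re (trace S) - \<tau> * inner e (S *v e)"
  using assms by (simp add: Phi_eq Re_trace_diff_scaleR Re_trace_ketbra_self sqrt_op_quadratic_form)

lemma Re_trace_nonneg: "positive_op A \<Longrightarrow> 0 \<le> Re (trace A)"
  unfolding trace_def Re_sum
  by (intro sum_nonneg) (metis Re_cinner cinner_axis_matrix_axis positive_op_iff)

section \<open>Convergence of the iteration\<close>

lemma decreasing_positive_ops_converge:
  fixes T :: "nat \<Rightarrow> complex^'n^'n"
  assumes p: "\<And>n. positive_op (T n)"
    and dec: "\<And>n x. inner x (T (Suc n) *v x) \<le> inner x (T n *v x)"
  obtains L where "T \<longlonglongrightarrow> L" "positive_op L"
proof -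
  have h: "adjoint_op (T n) = T n" for n
    using p by (simp add: positive_op_iff)
  have quad: "\<exists>l. (\<lambda>n. inner x (T n *v x)) \<longlonglongrightarrow> l" for x
  proof -
    have "decseq (\<lambda>n. inner x (T n *v x))"
      using dec by (rule decseq_SucI)
    moreover have "\<forall>n. 0 \<le> inner x (T n *v x)"
      using p by (simp add: positive_op_iff)
    ultimately show ?thesis
      by (metis decseq_convergent)
  qed
  have bilinear: "convergent (\<lambda>n. inner x (T n *v y))" for x y
  proof -
    obtain a b where "(\<lambda>n. inner (x + y) (T n *v (x + y))) \<longlonglongrightarrow> a"
      and "(\<lambda>n. inner (x - y) (T n *v (x - y))) \<longlonglongrightarrow> b"
      using quad by blast
    then have "(\<lambda>n. (inner (x + y) (T n *v (x + y)) - inner (x - y) (T n *v (x - y))) / 4)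
                 \<longlonglongrightarrow> (a - b) / 4"
      by (intro tendsto_intros) auto
    moreover have "(\<lambda>n. inner x (T n *v y))
        = (\<lambda>n. (inner (x + y) (T n *v (x + y)) - inner (x - y) (T n *v (x - y))) / 4)"
      by (rule ext) (rule hermitian_polarization[OF h])
    ultimately show ?thesis
      by (auto simp: convergent_def)
  qed
  have "convergent (\<lambda>n. Complex (inner (axis i 1) (T n *v axis j 1))
                                 (inner (\<i> *s axis i 1) (T n *v axis j 1)))" for i j
  proof -
    obtain a b where "(\<lambda>n. inner (axis i 1) (T n *v axis j 1)) \<longlonglongrightarrow> a"
      and "(\<lambda>n. inner (\<i> *s axis i 1) (T n *v axis j 1)) \<longlonglongrightarrow> b"
      using bilinear unfolding convergent_def by blast
    then show ?thesis
      using tendsto_Complex unfolding convergent_def by blast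
  qed
  then have entries: "convergent (\<lambda>n. T n $ i $ j)" for i j
    by (simp add: cinner_eq_Complex[symmetric] cinner_axis_matrix_axis)
  define L where "L = (\<chi> i j. lim (\<lambda>n. T n $ i $ j))"
  have TL: "T \<longlonglongrightarrow> L"
    using entries by (intro vec_tendstoI) (simp add: L_def convergent_LIMSEQ_iff)
  have "(\<lambda>n. adjoint_op (T n)) \<longlonglongrightarrow> adjoint_op L"
    by (rule tendsto_adjoint_op[OF TL])
  then have "adjoint_op L = L"
    using TL h by (simp add: LIMSEQ_unique)
  moreover have "0 \<le> inner x (L *v x)" for x
    using p by (intro LIMSEQ_le_const[OF tendsto_inner[OF tendsto_const tendsto_matrix_vector_mult[OF TL]]])
      (auto simp: positive_op_iff)
  ultimately show ?thesis
    using that TL by (simp add: positive_op_iff)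
qed

lemma Phi_iterates_tendsto:
  fixes T :: "nat \<Rightarrow> complex^'n^'n"
  assumes e: "norm e = 1" and \<tau>: "0 < \<tau>" "\<tau> \<le> 1"
    and T0: "positive_op (T 0)" and T: "\<And>n. T (Suc n) = Phi \<tau> e (T n)"
  obtains L where "T \<longlonglongrightarrow> L" "positive_op L" "L *v e = 0"
proof -
  have p: "positive_op (T n)" for n
    by (induction n) (simp_all add: T0 T positive_op_Phi e \<tau>)
  have "inner x (T (Suc n) *v x) \<le> inner x (T n *v x)" for n x
    using p \<tau> by (simp add: T Phi_quadratic_form_le)
  then obtain L where TL: "T \<longlonglongrightarrow> L" and pL: "positive_op L"
    by (rule decreasing_positive_ops_converge[OF p])
  have trace: "Re (trace (T N)) = Re (trace (T 0)) - \<tau> * (\<Sum>n<N. inner e (T n *v e))" for N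
    by (induction N) (simp_all add: T Re_trace_Phi[OF p] algebra_simps)
  have "\<tau> * (\<Sum>n<N. inner e (T n *v e)) \<le> Re (trace (T 0))" for N
    using trace[of N] Re_trace_nonneg[OF p, of N] by linarith
  then have "(\<Sum>n<N. inner e (T n *v e)) \<le> Re (trace (T 0)) / \<tau>" for N
    using \<tau> by (simp add: le_divide_eq mult.commute)
  moreover have "0 \<le> inner e (T n *v e)" for n
    using p by (simp add: positive_op_iff)
  ultimately have "(\<lambda>n. inner e (T n *v e)) \<longlonglongrightarrow> 0"
    by (intro summable_LIMSEQ_zero summableI_nonneg_bounded)
  moreover have "(\<lambda>n. inner e (T n *v e)) \<longlonglongrightarrow> inner e (L *v e)"
    by (intro tendsto_inner tendsto_const tendsto_matrix_vector_mult[OF TL])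
  ultimately have "inner e (L *v e) = 0"
    using LIMSEQ_unique by blast
  with pL have "L *v e = 0"
    by (rule positive_op_apply_eq_0)
  with TL pL that show ?thesis by blast
qed

theorem proposition4p3:
  fixes e :: "complex^'n" and \<tau> :: real
  assumes "norm e = 1" and "0 < \<tau>" and "\<tau> < 1"
  shows "(\<forall>S. positive_op S \<longrightarrow>
            ((Phi \<tau> e S = S \<longleftrightarrow> sqrt_op S *v e = 0) \<and>
             (sqrt_op S *v e = 0 \<longleftrightarrow> S *v e = 0) \<and>
             (S *v e = 0 \<longleftrightarrow> range ((*v) S) \<subseteq> orth_compl e)))
       \<and> (\<forall>S. positive_op S \<and> range ((*v) S) \<subseteq> orth_compl e \<longrightarrow> Phi \<tau> e S = S)
       \<and> (\<forall>T :: nat \<Rightarrow> complex^'n^'n. positive_op (T 0) \<and> (\<forall>n. T (Suc n) = Phi \<tau> e (T n)) \<longrightarrow>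
            convergent T \<and> Phi \<tau> e (lim T) = lim T \<and> lim T *v e = 0
            \<and> range ((*v) (lim T)) \<subseteq> orth_compl e)"
proof -
  have fixed_iff: "(Phi \<tau> e S = S \<longleftrightarrow> sqrt_op S *v e = 0) \<and>
                   (sqrt_op S *v e = 0 \<longleftrightarrow> S *v e = 0) \<and>
                   (S *v e = 0 \<longleftrightarrow> range ((*v) S) \<subseteq> orth_compl e)" if "positive_op S" for S
  proof -
    have "adjoint_op S = S"
      using that by (simp add: positive_op_iff)
    with that assms(2) show ?thesis
      using Phi_fixed_iff[OF that] sqrt_op_apply_eq_0_iff[OF that]
        hermitian_apply_eq_0_iff_range_orth[of S e] by simp
  qed
  moreover have "convergent T \<and> Phi \<tau> e (lim T) = lim T \<and> lim T *v e = 0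
                   \<and> range ((*v) (lim T)) \<subseteq> orth_compl e"
    if T0: "positive_op (T 0)" and T: "\<forall>n. T (Suc n) = Phi \<tau> e (T n)"
    for T :: "nat \<Rightarrow> complex^'n^'n"
  proof -
    have "\<And>n. T (Suc n) = Phi \<tau> e (T n)"
      using T by simp
    then obtain L where "T \<longlonglongrightarrow> L" "positive_op L" "L *v e = 0"
      by (rule Phi_iterates_tendsto[where T = T, OF assms(1,2) less_imp_le[OF assms(3)] T0])
    then show ?thesis
      using fixed_iff[of L] by (auto simp: convergent_def limI)
  qed
  ultimately show ?thesis
    by blast
qed

end
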